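(* Suppose regularity conditions R3–R5 (listed in the context) hold. Then, under the hierarchical model M2 with the prior $$\pi_i(A)\propto\mathrm{tr}[V^{-2}]\,(A+D_i)\,A,\qquad A>0,$$ the posterior of $A$ is proper, i.e. $$\int_0^\infty\pi_i(A\mid y)\,dA<\infty,\qquad\text{where }\pi_i(A\mid y)\propto\pi_i(A)\,L_{\mathrm{RE}}(A),$$ provided $m>p+2$.
   Context: Model M2. For $i=1,\dots,m$: Level 1: $y_i\mid\theta_i\sim N(\theta_i,D_i)$ independently, with known $D_i>0$; Level 2: $\theta_i\mid\beta,A\sim N(x_i'\beta,A)$ independently, with known $x_i\in\mathbb R^p$, $p<m$; Level 3: prior density $p(\beta,A)\propto\pi_i(A)$ (flat in $\beta$), $\beta\in\mathbb R^p$, $A>0$. Notation. $y=(y_1,\dots,y_m)'$; $X=(x_1,\dots,x_m)'$; $V=V(A)=\mathrm{diag}(A+D_1,\dots,A+D_m)$, so $\mathrm{tr}[V^{-2}]=\sum_{u=1}^m(A+D_u)^{-2}$; $P=V^{-1}-V^{-1}X(X'V^{-1}X)^{-1}X'V^{-1}$; $q_j=x_j'(X'X)^{-1}x_j$. The REML (residual) likelihood is $L_{\mathrm{RE}}(A)=|V|^{-1/2}|X'V^{-1}X|^{-1/2}\exp(-\tfrac12y'Py)$. The symbol $\propto$ hides positive factors not depending on $A$. Regularity conditions. R3: $\mathrm{rank}(X)=p$. R4: the elements of $X$ are uniformly bounded, implying $\sup_{j\ge1}q_j=O(m^{-1})$. R5: $0<\inf_{j\ge1}D_j\le\sup_{j\ge1}D_j<\infty$,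 $A\in(0,\infty)$. *)

theory Defs
  imports
    "HOL-Analysis.Set_Integral"
    "HOL-Analysis.Lebesgue_Measure"
    "HOL-Library.Landau_Symbols"
    "HOL-Library.Extended_Real"
    "Jordan_Normal_Form.Gauss_Jordan_Elimination"
    "Jordan_Normal_Form.Determinant"
    "Jordan_Normal_Form.DL_Rank"
begin

text \<open>
  Covariates and sampling variances are infinite sequences \<open>x 1, x 2, \<dots>\<close> and \<open>D 1, D 2, \<dots>\<close>,
  because the regularity conditions are asymptotic in the number \<open>m\<close> of areas; the model
  with \<open>m\<close> areas uses the first \<open>m\<close> terms. Index 0 of the sequences is never used.
\<close>

definition minv :: "real mat \<Rightarrow> real mat" where
  "minv M = the (mat_inverse M)"

definition design :: "nat \<Rightarrow> (nat \<Rightarrow> real vec) \<Rightarrow> nat \<Rightarrow> real mat" where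
  "design p x m = mat_of_rows p (map x [1..<Suc m])"

text \<open>Matrix indices start at 0, so the \<open>u\<close>-th diagonal entry belongs to area \<open>u + 1\<close>.\<close>

definition Vmat :: "(nat \<Rightarrow> real) \<Rightarrow> nat \<Rightarrow> real \<Rightarrow> real mat" where
  "Vmat D m A = mat_diag m (\<lambda>u. A + D (Suc u))"

definition XVX :: "nat \<Rightarrow> (nat \<Rightarrow> real vec) \<Rightarrow> (nat \<Rightarrow> real) \<Rightarrow> nat \<Rightarrow> real \<Rightarrow> real mat" where
  "XVX p x D m A = transpose_mat (design p x m) * minv (Vmat D m A) * design p x m"

definition Pmat :: "nat \<Rightarrow> (nat \<Rightarrow> real vec) \<Rightarrow> (nat \<Rightarrow> real) \<Rightarrow> nat \<Rightarrow> real \<Rightarrow> real mat" where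
  "Pmat p x D m A =
     minv (Vmat D m A)
     - minv (Vmat D m A) * design p x m * minv (XVX p x D m A)
         * transpose_mat (design p x m) * minv (Vmat D m A)"

text \<open>
  Residual likelihood of \<open>A\<close>: the marginal density of \<open>y\<close> in the model
  \<open>y\<^sub>i | \<theta>\<^sub>i \<sim> N(\<theta>\<^sub>i, D\<^sub>i)\<close>, \<open>\<theta>\<^sub>i | \<beta>, A \<sim> N(x\<^sub>i'\<beta>, A)\<close>, after integrating out \<open>\<theta>\<close> and,
  with respect to its flat prior, \<open>\<beta>\<close>; factors not depending on \<open>A\<close> are dropped. Hence the
  posterior density of \<open>A\<close> is proportional to its prior density times this function.
\<close>

definition L_RE ::
  "nat \<Rightarrow> (nat \<Rightarrow> real vec) \<Rightarrow> (nat \<Rightarrow> real) \<Rightarrow> nat \<Rightarrow> real vec \<Rightarrow> real \<Rightarrow> real" where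
  "L_RE p x D m y A =
     Determinant.det (Vmat D m A) powr (- 1 / 2)
     * Determinant.det (XVX p x D m A) powr (- 1 / 2)
     * exp (- 1 / 2 * scalar_prod y (Pmat p x D m A *\<^sub>v y))"

definition trace_Vinv2 :: "(nat \<Rightarrow> real) \<Rightarrow> nat \<Rightarrow> real \<Rightarrow> real" where
  "trace_Vinv2 D m A = sum_list (diag_mat (minv (Vmat D m A) ^\<^sub>m 2))"

definition leverage :: "nat \<Rightarrow> (nat \<Rightarrow> real vec) \<Rightarrow> nat \<Rightarrow> nat \<Rightarrow> real" where
  "leverage p x m j =
     scalar_prod (x j) (minv (transpose_mat (design p x m) * design p x m) *\<^sub>v x j)"

definition cond_R3 :: "nat \<Rightarrow> (nat \<Rightarrow> real vec) \<Rightarrow> nat \<Rightarrow> bool" where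
  "cond_R3 p x m \<longleftrightarrow> vec_space.rank m (design p x m) = p"

text \<open>
  Uniform boundedness of the covariates does not by itself force the leverages
  \<open>q\<^sub>j\<close> to decay like \<open>1/n\<close>, so the rate is recorded as a separate part of the condition.
  The leverages of the design with \<open>n\<close> areas exist for \<open>j = 1, \<dots>, n\<close> only.
\<close>

definition cond_R4 :: "nat \<Rightarrow> (nat \<Rightarrow> real vec) \<Rightarrow> bool" where
  "cond_R4 p x \<longleftrightarrow>
     (\<exists>B. \<forall>j\<ge>1. \<forall>k<p. \<bar>vec_index (x j) k\<bar> \<le> B) \<and>
     (\<lambda>n. Max (leverage p x n ` {1..n})) \<in> O(\<lambda>n. 1 / real n)"

text \<open>Taken in the extended reals, infimum and supremum need no boundedness side conditions.\<close>

definition cond_R5 :: "(nat \<Rightarrow> real) \<Rightarrow> bool" where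
  "cond_R5 D \<longleftrightarrow>
     0 < (INF j\<in>{1..}. ereal (D j)) \<and> (SUP j\<in>{1..}. ereal (D j)) < \<infinity>"

text \<open>The parameter \<open>A\<close> ranges over the positive reals; values elsewhere are irrelevant.\<close>

definition prop_to :: "(real \<Rightarrow> real) \<Rightarrow> (real \<Rightarrow> real) \<Rightarrow> bool" (infix \<open>\<propto>\<close> 50) where
  "f \<propto> g \<longleftrightarrow> (\<exists>c>0. \<forall>A>0. f A = c * g A)"

end

theory Submission
  imports Defs "HOL-Analysis.Equivalence_Lebesgue_Henstock_Integration"
begin

text \<open>
  The product of prior and residual likelihood can fail to be integrable only at the two ends of
  the half-line \<open>A > 0\<close>.

  At \<open>A = 0\<close> nothing happens, because all \<open>D u\<close> are positive: \<open>V\<close> stays invertible there, and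
  by the rank condition so does \<open>X' V\<^sup>-\<^sup>1 X\<close>. Hence the product extends continuously to
  \<open>A = 0\<close> (\<open>prior_factor_continuous\<close>, \<open>L_RE_continuous\<close>). Continuity also supplies
  measurability.

  At infinity \<open>V\<close> behaves like \<open>A\<close> times the identity. The prior \<open>tr(V\<^sup>-\<^sup>2) (A + D i) A\<close> stays
  bounded; \<open>|V|\<close> to the power \<open>-1/2\<close> is at most \<open>A\<close> to the power \<open>-m/2\<close>; and
  \<open>A X' V\<^sup>-\<^sup>1 X\<close> tends to the nonsingular matrix \<open>X' X\<close>, so \<open>|X' V\<^sup>-\<^sup>1 X|\<close> to the power \<open>-1/2\<close>
  is of order \<open>A\<close> to the power \<open>p/2\<close> (\<open>scaled_det_XVX_tendsto\<close>). The exponential is at most 1,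
  because \<open>y' P y\<close> is a weighted residual sum of squares
  (\<open>residual_quadratic_form_nonneg\<close>). Altogether the tail is of order \<open>A\<close> to the power
  \<open>-(m - p)/2\<close> (\<open>L_RE_bigo\<close>), which is integrable when \<open>m > p + 2\<close>.
\<close>

section \<open>Entrywise convergence of matrices\<close>

text \<open>
  The dimensions of a matrix belong to its value, so they are part of the notion of convergence.
  They are required only eventually, because \<^term>\<open>minv\<close> of a singular matrix is an
  unspecified value of unknown dimensions; near a nonsingular limit this does not occur.
\<close>

definition mat_tendsto ::
  "nat \<Rightarrow> nat \<Rightarrow> ('t \<Rightarrow> real mat) \<Rightarrow> real mat \<Rightarrow> 't filter \<Rightarrow> bool" where
  "mat_tendsto nr nc M L F \<longleftrightarrow>
     (\<forall>\<^sub>F t in F. M t \<in> carrier_mat nr nc) \<and> L \<in> carrier_mat nr nc \<and>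
     (\<forall>i<nr. \<forall>j<nc. ((\<lambda>t. M t $$ (i, j)) \<longlongrightarrow> L $$ (i, j)) F)"

lemma mat_tendsto_const:
  "L \<in> carrier_mat nr nc \<Longrightarrow> mat_tendsto nr nc (\<lambda>_. L) L F"
  by (simp add: mat_tendsto_def)

lemma mat_tendsto_mult:
  assumes M: "mat_tendsto nr k M L F" and N: "mat_tendsto k nc N K F"
  shows "mat_tendsto nr nc (\<lambda>t. M t * N t) (L * K) F"
proof -
  have car: "\<forall>\<^sub>F t in F. M t \<in> carrier_mat nr k \<and> N t \<in> carrier_mat k nc"
    using M N by (simp add: mat_tendsto_def eventually_conj)
  have prod: "(S * T) $$ (i, j) = (\<Sum>l = 0..<k. S $$ (i, l) * T $$ (l, j))"
    if "S \<in> carrier_mat nr k" "T \<in> carrier_mat k nc" "i < nr" "j < nc" for S T :: "real mat" and i j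
    using that by (simp add: scalar_prod_def)
  have "((\<lambda>t. (M t * N t) $$ (i, j)) \<longlongrightarrow> (L * K) $$ (i, j)) F"
    if ij: "i < nr" "j < nc" for i j
  proof (rule Lim_transform_eventually)
    show "\<forall>\<^sub>F t in F. (\<Sum>l = 0..<k. M t $$ (i, l) * N t $$ (l, j))
        = (M t * N t) $$ (i, j)"
      using car by eventually_elim (simp add: prod ij)
    have "(L * K) $$ (i, j) = (\<Sum>l = 0..<k. L $$ (i, l) * K $$ (l, j))"
      using M N by (intro prod ij) (auto simp: mat_tendsto_def)
    then show "((\<lambda>t. \<Sum>l = 0..<k. M t $$ (i, l) * N t $$ (l, j))
        \<longlongrightarrow> (L * K) $$ (i, j)) F"
      using M N ij unfolding mat_tendsto_def by (auto intro!: tendsto_intros)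
  qed
  moreover have "\<forall>\<^sub>F t in F. M t * N t \<in> carrier_mat nr nc"
    using car by eventually_elim auto
  ultimately show ?thesis
    using M N by (auto simp: mat_tendsto_def)
qed

lemma mat_tendsto_minus:
  assumes M: "mat_tendsto nr nc M L F" and N: "mat_tendsto nr nc N K F"
  shows "mat_tendsto nr nc (\<lambda>t. M t - N t) (L - K) F"
proof -
  have car: "\<forall>\<^sub>F t in F. M t \<in> carrier_mat nr nc \<and> N t \<in> carrier_mat nr nc"
    using M N by (simp add: mat_tendsto_def eventually_conj)
  have "((\<lambda>t. (M t - N t) $$ (i, j)) \<longlongrightarrow> (L - K) $$ (i, j)) F"
    if ij: "i < nr" "j < nc" for i j
  proof (rule Lim_transform_eventually)
    show "\<forall>\<^sub>F t in F. M t $$ (i, j) - N t $$ (i, j) = (M t - N t) $$ (i, j)"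
      using car by eventually_elim (use ij in auto)
    have "(L - K) $$ (i, j) = L $$ (i, j) - K $$ (i, j)"
      using N ij by (auto simp: mat_tendsto_def)
    then show "((\<lambda>t. M t $$ (i, j) - N t $$ (i, j))
        \<longlongrightarrow> (L - K) $$ (i, j)) F"
      using M N ij unfolding mat_tendsto_def by (auto intro!: tendsto_intros)
  qed
  moreover have "\<forall>\<^sub>F t in F. M t - N t \<in> carrier_mat nr nc"
    using car by eventually_elim auto
  ultimately show ?thesis
    using M N by (auto simp: mat_tendsto_def)
qed

lemma mat_tendsto_det:
  assumes M: "mat_tendsto n n M L F"
  shows "((\<lambda>t. det (M t)) \<longlongrightarrow> det L) F"
proof (rule Lim_transform_eventually)
  have car: "\<forall>\<^sub>F t in F. M t \<in> carrier_mat n n" and L: "L \<in> carrier_mat n n"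
    using M by (auto simp: mat_tendsto_def)
  show "\<forall>\<^sub>F t in F. (\<Sum>p | p permutes {0..<n}. signof p * (\<Prod>i = 0..<n. M t $$ (i, p i)))
      = det (M t)"
    using car by eventually_elim (simp add: det_def')
  have "p i < n" if "p permutes {0..<n}" "i < n" for p i
    using permutes_in_image[OF that(1), of i] that(2) by simp
  then show "((\<lambda>t. \<Sum>p | p permutes {0..<n}. signof p * (\<Prod>i = 0..<n. M t $$ (i, p i)))
      \<longlongrightarrow> det L) F"
    unfolding det_def'[OF L] using M
    by (intro tendsto_sum tendsto_mult tendsto_prod tendsto_const) (auto simp: mat_tendsto_def)
qed

lemma minv_inverts:
  assumes M: "M \<in> carrier_mat n n" and "det M \<noteq> 0"
  shows "minv M \<in> carrier_mat n n" "M * minv M = 1\<^sub>m n" "minv M * M = 1\<^sub>m n"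
proof -
  have "M \<in> Units (ring_mat TYPE(real) n ())"
    using det_non_zero_imp_unit[OF assms] .
  then obtain B where "mat_inverse M = Some B"
    using mat_inverse(1)[OF M, of "()"] by (cases "mat_inverse M") auto
  then show "minv M \<in> carrier_mat n n" "M * minv M = 1\<^sub>m n" "minv M * M = 1\<^sub>m n"
    using mat_inverse(2)[OF M] by (auto simp: minv_def)
qed

lemma minv_eqI:
  assumes M: "M \<in> carrier_mat n n" and B: "B \<in> carrier_mat n n" and MB: "M * B = 1\<^sub>m n"
  shows "minv M = B"
proof -
  have "det M * det B = 1"
    using det_mult[OF M B] MB by simp
  then have "det M \<noteq> 0" by auto
  note inv = minv_inverts[OF M this]
  have "minv M = minv M * (M * B)" using inv(1) MB by simp
  also have "\<dots> = B" using inv M B by (simp flip: assoc_mult_mat)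
  finally show ?thesis .
qed

lemma minv_index:
  assumes M: "M \<in> carrier_mat n n" and det: "det M \<noteq> 0" and "i < n" "j < n"
  shows "minv M $$ (i, j) = cofactor M j i / det M"
proof -
  have "M * ((1 / det M) \<cdot>\<^sub>m adj_mat M) = 1\<^sub>m n"
    using adj_mat[OF M] M det by (auto simp: mult_smult_distrib[OF M])
  then have "minv M = (1 / det M) \<cdot>\<^sub>m adj_mat M"
    using adj_mat(1)[OF M] by (intro minv_eqI[OF M]) auto
  then show ?thesis
    using assms by (simp add: adj_mat_def)
qed

text \<open>
  By Cramer's rule the entries of the inverse are quotients of determinants, hence continuous
  wherever the determinant does not vanish.
\<close>

lemma mat_tendsto_minv:
  assumes M: "mat_tendsto n n M L F" and det: "det L \<noteq> 0"
  shows "mat_tendsto n n (\<lambda>t. minv (M t)) (minv L) F"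
proof -
  have L: "L \<in> carrier_mat n n" using M by (simp add: mat_tendsto_def)
  have lim: "((\<lambda>t. det (M t)) \<longlongrightarrow> det L) F"
    by (rule mat_tendsto_det[OF M])
  have ev: "\<forall>\<^sub>F t in F. M t \<in> carrier_mat n n \<and> det (M t) \<noteq> 0"
    using M tendsto_imp_eventually_ne[OF lim det] by (simp add: mat_tendsto_def eventually_conj)
  have "((\<lambda>t. minv (M t) $$ (i, j)) \<longlongrightarrow> minv L $$ (i, j)) F"
    if ij: "i < n" "j < n" for i j
  proof (rule Lim_transform_eventually)
    show "\<forall>\<^sub>F t in F. cofactor (M t) j i / det (M t) = minv (M t) $$ (i, j)"
      using ev by eventually_elim (simp add: minv_index[OF _ _ ij])
    have "mat_tendsto (n - 1) (n - 1) (\<lambda>t. mat_delete (M t) j i) (mat_delete L j i) F"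
      unfolding mat_tendsto_def
    proof (intro conjI allI impI)
      show "\<forall>\<^sub>F t in F. mat_delete (M t) j i \<in> carrier_mat (n - 1) (n - 1)"
        using ev by eventually_elim (blast intro: mat_delete_carrier)
      show "mat_delete L j i \<in> carrier_mat (n - 1) (n - 1)"
        using L by (rule mat_delete_carrier)
      fix k l assume kl: "k < n - 1" "l < n - 1"
      \<comment> \<open>Positions in the minor, shifted past the deleted row and column.\<close>
      let ?k = "if k < j then k else Suc k" and ?l = "if l < i then l else Suc l"
      show "((\<lambda>t. mat_delete (M t) j i $$ (k, l)) \<longlongrightarrow> mat_delete L j i $$ (k, l)) F"
      proof (rule Lim_transform_eventually)
        show "\<forall>\<^sub>F t in F. M t $$ (?k, ?l) = mat_delete (M t) j i $$ (k, l)"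
          using ev by eventually_elim (use kl in \<open>auto simp: mat_delete_def\<close>)
        have "mat_delete L j i $$ (k, l) = L $$ (?k, ?l)"
          using L kl by (auto simp: mat_delete_def)
        then show "((\<lambda>t. M t $$ (?k, ?l)) \<longlongrightarrow> mat_delete L j i $$ (k, l)) F"
          using M kl by (auto simp: mat_tendsto_def)
      qed
    qed
    then show "((\<lambda>t. cofactor (M t) j i / det (M t)) \<longlongrightarrow> minv L $$ (i, j)) F"
      unfolding minv_index[OF L det ij] cofactor_def
      by (intro tendsto_intros mat_tendsto_det lim det)
  qed
  moreover have "\<forall>\<^sub>F t in F. minv (M t) \<in> carrier_mat n n"
    using ev by eventually_elim (simp add: minv_inverts(1))
  ultimately show ?thesis
    using minv_inverts(1)[OF L det] by (simp add: mat_tendsto_def)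
qed

lemma quadratic_form_sum:
  fixes M :: "real mat"
  assumes "M \<in> carrier_mat n n" "v \<in> carrier_vec n"
  shows "scalar_prod v (M *\<^sub>v v)
    = (\<Sum>i = 0..<n. v $ i * (\<Sum>j = 0..<n. M $$ (i, j) * v $ j))"
  using assms by (simp add: scalar_prod_def)

lemma mat_tendsto_quadratic_form:
  assumes M: "mat_tendsto n n M L F" and v: "v \<in> carrier_vec n"
  shows "((\<lambda>t. scalar_prod v (M t *\<^sub>v v)) \<longlongrightarrow> scalar_prod v (L *\<^sub>v v)) F"
proof (rule Lim_transform_eventually)
  have car: "\<forall>\<^sub>F t in F. M t \<in> carrier_mat n n" and L: "L \<in> carrier_mat n n"
    using M by (auto simp: mat_tendsto_def)
  show "\<forall>\<^sub>F t in F. (\<Sum>i = 0..<n. v $ i * (\<Sum>j = 0..<n. M t $$ (i, j) * v $ j))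
      = scalar_prod v (M t *\<^sub>v v)"
    using car by eventually_elim (simp add: quadratic_form_sum[OF _ v])
  show "((\<lambda>t. \<Sum>i = 0..<n. v $ i * (\<Sum>j = 0..<n. M t $$ (i, j) * v $ j))
      \<longlongrightarrow> scalar_prod v (L *\<^sub>v v)) F"
    unfolding quadratic_form_sum[OF L v] using M
    by (intro tendsto_sum tendsto_mult tendsto_const) (auto simp: mat_tendsto_def)
qed

lemma mat_tendsto_mat_diag:
  assumes "\<And>u. u < m \<Longrightarrow> ((\<lambda>t. w t u) \<longlongrightarrow> l u) F"
  shows "mat_tendsto m m (\<lambda>t. mat_diag m (w t)) (mat_diag m l) F"
  using assms by (auto simp: mat_tendsto_def mat_diag_def)

section \<open>Weighted Gram matrices and residual sums of squares\<close>

lemma mat_diag_mult_vec: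
  fixes w :: "nat \<Rightarrow> real"
  assumes "r \<in> carrier_vec m"
  shows "mat_diag m w *\<^sub>v r = vec m (\<lambda>u. w u * r $ u)"
proof (rule eq_vecI)
  fix u assume "u < dim_vec (vec m (\<lambda>u. w u * r $ u))"
  then have u: "u < m" by simp
  have "(mat_diag m w *\<^sub>v r) $ u = (\<Sum>k = 0..<m. (if u = k then w k else 0) * r $ k)"
    using assms u by (simp add: mat_diag_def scalar_prod_def)
  also have "\<dots> = (\<Sum>k = 0..<m. if u = k then w u * r $ u else 0)"
    by (rule sum.cong) auto
  finally show "(mat_diag m w *\<^sub>v r) $ u = vec m (\<lambda>u. w u * r $ u) $ u"
    using u by simp
qed (simp add: mat_diag_def)

lemma mat_diag_quadratic_form:
  fixes w :: "nat \<Rightarrow> real"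
  assumes "r \<in> carrier_vec m"
  shows "scalar_prod r (mat_diag m w *\<^sub>v r) = (\<Sum>u<m. w u * (r $ u)\<^sup>2)"
  using assms
  by (simp add: mat_diag_mult_vec scalar_prod_def power2_eq_square ac_simps lessThan_atLeast0)

lemma det_mat_diag: "det (mat_diag m w) = (\<Prod>u<m. w u)"
  by (subst det_upper_triangular[where n = m])
    (auto simp: mat_diag_def diag_mat_def upper_triangular_def prod.list_conv_set_nth
      lessThan_atLeast0)

lemma minv_mat_diag:
  assumes "\<And>u. u < m \<Longrightarrow> w u \<noteq> 0"
  shows "minv (mat_diag m w) = mat_diag m (\<lambda>u. 1 / w u)"
proof (rule minv_eqI)
  have "mat_diag m (\<lambda>u. w u * (1 / w u)) = 1\<^sub>m m"
    using assms by (intro eq_matI) (auto simp: mat_diag_def)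
  then show "mat_diag m w * mat_diag m (\<lambda>u. 1 / w u) = 1\<^sub>m m"
    by simp
qed auto

definition weighted_gram :: "nat \<Rightarrow> real mat \<Rightarrow> (nat \<Rightarrow> real) \<Rightarrow> real mat" where
  "weighted_gram m X w = transpose_mat X * mat_diag m w * X"

lemma weighted_gram_carrier: "X \<in> carrier_mat m p \<Longrightarrow> weighted_gram m X w \<in> carrier_mat p p"
  by (auto simp: weighted_gram_def)

lemma mat_tendsto_weighted_gram:
  assumes X: "X \<in> carrier_mat m p" and "\<And>u. u < m \<Longrightarrow> ((\<lambda>t. w t u) \<longlongrightarrow> l u) F"
  shows "mat_tendsto p p (\<lambda>t. weighted_gram m X (w t)) (weighted_gram m X l) F"
  unfolding weighted_gram_def using assms
  by (intro mat_tendsto_mult[where k = m] mat_tendsto_const mat_tendsto_mat_diag) auto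

lemma weighted_gram_quadratic_form:
  assumes X: "X \<in> carrier_mat m p" and v: "v \<in> carrier_vec p"
  shows "scalar_prod v (weighted_gram m X w *\<^sub>v v) = (\<Sum>u<m. w u * ((X *\<^sub>v v) $ u)\<^sup>2)"
proof -
  have Xv: "X *\<^sub>v v \<in> carrier_vec m" using X v by simp
  have car: "transpose_mat X \<in> carrier_mat p m" "mat_diag m w \<in> carrier_mat m m"
    using X by auto
  let ?z = "mat_diag m w *\<^sub>v (X *\<^sub>v v)"
  have z: "?z \<in> carrier_vec m" using mult_mat_vec_carrier[OF car(2) Xv] .
  have "weighted_gram m X w *\<^sub>v v = transpose_mat X *\<^sub>v ?z"
    using car X v Xv
    by (simp add: weighted_gram_def assoc_mult_mat_vec[of _ p m _ p]
        assoc_mult_mat_vec[of _ p m _ m])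
  then have "scalar_prod v (weighted_gram m X w *\<^sub>v v) = scalar_prod (X *\<^sub>v v) ?z"
    using transpose_vec_mult_scalar[OF X v z] comm_scalar_prod[OF v, of "transpose_mat X *\<^sub>v ?z"]
      comm_scalar_prod[OF Xv z] car z by simp
  then show ?thesis
    by (simp add: mat_diag_quadratic_form[OF Xv])
qed

text \<open>
  Along the segment from \<open>M\<close> to the identity matrix every matrix is positive definite, hence
  nonsingular. The determinant is continuous there, has no zero, and ends at 1, so it is positive
  throughout.
\<close>

lemma det_pos_if_positive_definite:
  fixes M :: "real mat"
  assumes M: "M \<in> carrier_mat n n"
    and pos: "\<And>v. v \<in> carrier_vec n \<Longrightarrow> v \<noteq> 0\<^sub>v n \<Longrightarrow> 0 < scalar_prod v (M *\<^sub>v v)"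
  shows "0 < det M"
proof -
  define N where "N s = s \<cdot>\<^sub>m 1\<^sub>m n + (1 - s) \<cdot>\<^sub>m M" for s :: real
  have N: "N s \<in> carrier_mat n n" for s using M by (simp add: N_def)
  have nonzero: "det (N s) \<noteq> 0" if s: "0 \<le> s" "s \<le> 1" for s
  proof
    assume "det (N s) = 0"
    then obtain v where v: "v \<in> carrier_vec n" "v \<noteq> 0\<^sub>v n" "N s *\<^sub>v v = 0\<^sub>v n"
      using det_0_iff_vec_prod_zero_field[OF N] by blast
    have vv: "0 < scalar_prod v v"
    proof -
      obtain k where k: "k < n" "v $ k \<noteq> 0"
        using v(1,2) by (metis carrier_vecD eq_vecI index_zero_vec)
      have "0 < (\<Sum>k = 0..<n. v $ k * v $ k)"
        using k by (intro sum_pos2[of _ k]) (auto simp: zero_less_mult_iff linorder_neq_iff)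
      then show ?thesis using v(1) by (simp add: scalar_prod_def)
    qed
    have "N s *\<^sub>v v = s \<cdot>\<^sub>v v + (1 - s) \<cdot>\<^sub>v (M *\<^sub>v v)"
      using M v(1) unfolding N_def
      by (subst add_mult_distrib_mat_vec[of _ n n]) auto
    then have "s \<cdot>\<^sub>v v + (1 - s) \<cdot>\<^sub>v (M *\<^sub>v v) = 0\<^sub>v n"
      using v(3) by simp
    then have "0 = scalar_prod v (s \<cdot>\<^sub>v v + (1 - s) \<cdot>\<^sub>v (M *\<^sub>v v))"
      using scalar_prod_right_zero[OF v(1)] by simp
    also have "\<dots> = s * scalar_prod v v + (1 - s) * scalar_prod v (M *\<^sub>v v)"
      using M v(1) by (subst scalar_prod_add_distrib[of _ n]) auto
    finally have eq: "s * scalar_prod v v + (1 - s) * scalar_prod v (M *\<^sub>v v) = 0" ..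
    have "0 < s * scalar_prod v v + (1 - s) * scalar_prod v (M *\<^sub>v v)"
    proof (cases "s = 0")
      case True then show ?thesis using pos[OF v(1,2)] by simp
    next
      case False
      then show ?thesis using s vv pos[OF v(1,2)]
        by (intro add_pos_nonneg mult_pos_pos mult_nonneg_nonneg) auto
    qed
    with eq show False by simp
  qed
  have cont: "continuous_on {0..1} (\<lambda>s. det (N s))"
    unfolding continuous_on_def
  proof
    fix s :: real
    have "((\<lambda>s. N s $$ (i, j)) \<longlongrightarrow> N s $$ (i, j)) (at s within {0..1})" if "i < n" "j < n" for i j
      using that M by (auto simp: N_def intro!: tendsto_intros)
    then have "mat_tendsto n n N (N s) (at s within {0..1})"
      using N by (simp add: mat_tendsto_def)
    then show "((\<lambda>s. det (N s)) \<longlongrightarrow> det (N s)) (at s within {0..1})"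
      by (rule mat_tendsto_det)
  qed
  have N0: "N 0 = M" and N1: "N 1 = 1\<^sub>m n"
    using M by (auto simp: N_def intro!: eq_matI)
  show ?thesis
  proof (rule ccontr)
    assume "\<not> 0 < det M"
    then have "\<exists>s\<ge>0. s \<le> 1 \<and> det (N s) = 0"
      using N0 N1 cont by (intro IVT') auto
    with nonzero show False by blast
  qed
qed

lemma (in vec_space) inj_if_full_column_rank:
  assumes A: "A \<in> carrier_mat n nc" and rank: "rank A = nc"
    and v: "v \<in> carrier_vec nc" and Av: "A *\<^sub>v v = 0\<^sub>v n"
  shows "v = 0\<^sub>v nc"
proof (rule ccontr)
  assume nz: "v \<noteq> 0\<^sub>v nc"
  have "lin_indpt {}"
    by (rule finite_lin_indpt2) auto
  then obtain S where S: "maximal S (\<lambda>T. T \<subseteq> set (cols A) \<and> lin_indpt T)"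
    using maximal_exists_superset[of "set (cols A)" "\<lambda>T. T \<subseteq> set (cols A) \<and> lin_indpt T" "{}"]
    by auto
  then have "card S \<le> card (set (cols A))"
    by (simp add: card_mono maximal_def)
  then have "length (cols A) \<le> card (set (cols A))"
    using rank_card_indpt[OF A S] rank A by simp
  \<comment> \<open>The results on independent columns speak of the set of columns, so a repeated column must be
    excluded first: it would make that set too small for the rank.\<close>
  then have dist: "distinct (cols A)"
    by (intro card_distinct le_antisym card_length)
  show False
    using lin_depI[OF A v nz Av dist] full_rank_lin_indpt[OF A rank dist] by blast
qed

text \<open>
  The quadratic form of the weighted Gram matrix is a weighted sum of squares of the entries of
  \<open>X v\<close>, and full column rank keeps \<open>X v\<close> away from 0.
\<close>

lemma det_weighted_gram_pos:
  assumes X: "X \<in> carrier_mat m p" and rank: "vec_space.rank m X = p"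
    and w: "\<And>u. u < m \<Longrightarrow> 0 < w u"
  shows "0 < det (weighted_gram m X w)"
proof (rule det_pos_if_positive_definite[OF weighted_gram_carrier[OF X]])
  fix v :: "real vec" assume v: "v \<in> carrier_vec p" "v \<noteq> 0\<^sub>v p"
  interpret vec_space "TYPE(real)" m .
  have "X *\<^sub>v v \<noteq> 0\<^sub>v m"
    using inj_if_full_column_rank[OF X rank v(1)] v(2) by blast
  moreover have "dim_vec (X *\<^sub>v v) = m" using X by simp
  ultimately obtain u where u: "u < m" "(X *\<^sub>v v) $ u \<noteq> 0"
    by (metis eq_vecI index_zero_vec)
  have "0 < (\<Sum>u<m. w u * ((X *\<^sub>v v) $ u)\<^sup>2)"
  proof (rule sum_pos2)
    show "0 < w u * ((X *\<^sub>v v) $ u)\<^sup>2" using u w by simp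
    show "0 \<le> w k * ((X *\<^sub>v v) $ k)\<^sup>2" if "k \<in> {..<m}" for k
      using that w[of k] by simp
  qed (use u in auto)
  then show "0 < scalar_prod v (weighted_gram m X w *\<^sub>v v)"
    by (simp add: weighted_gram_quadratic_form[OF X v(1)])
qed

text \<open>
  With \<open>b\<close> the generalized least squares estimate and \<open>r = y - X b\<close> its residual, the quadratic
  form equals \<open>r' W r\<close>: the matrix maps \<open>y\<close> to \<open>W r\<close>, and the normal equations \<open>X' W r = 0\<close> remove
  the contribution of the fitted part \<open>X b\<close> of \<open>y\<close>.
\<close>

lemma residual_quadratic_form_nonneg:
  fixes m :: nat and X :: "real mat" and w :: "nat \<Rightarrow> real"
  defines "W \<equiv> mat_diag m w"
  assumes X: "X \<in> carrier_mat m p" and det: "det (weighted_gram m X w) \<noteq> 0"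
    and w: "\<And>u. u < m \<Longrightarrow> 0 \<le> w u" and y: "y \<in> carrier_vec m"
  shows "0 \<le> scalar_prod y ((W - W * X * minv (weighted_gram m X w) * transpose_mat X * W) *\<^sub>v y)"
proof -
  define G where "G = weighted_gram m X w"
  define H where "H = minv G"
  define b where "b = H *\<^sub>v (transpose_mat X *\<^sub>v (W *\<^sub>v y))"
  define r where "r = y - X *\<^sub>v b"
  have XT: "transpose_mat X \<in> carrier_mat p m" and W: "W \<in> carrier_mat m m"
    and G: "G \<in> carrier_mat p p"
    using X weighted_gram_carrier[OF X] by (auto simp: W_def G_def)
  have H: "H \<in> carrier_mat p p" "G * H = 1\<^sub>m p"
    using minv_inverts[of G p] G det by (auto simp: H_def G_def)
  have Wy: "W *\<^sub>v y \<in> carrier_vec m" and XWy: "transpose_mat X *\<^sub>v (W *\<^sub>v y) \<in> carrier_vec p"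
    using W y XT by auto
  have b: "b \<in> carrier_vec p" using H XWy by (simp add: b_def)
  have Xb: "X *\<^sub>v b \<in> carrier_vec m" using X b by simp
  have r: "r \<in> carrier_vec m" using Xb y by (simp add: r_def)
  have Wr: "W *\<^sub>v r \<in> carrier_vec m" using W r by simp
  have "(W * X * H * transpose_mat X * W) *\<^sub>v y = W *\<^sub>v (X *\<^sub>v b)"
  proof -
    have 1: "W * X \<in> carrier_mat m p" using W X by simp
    have 2: "W * X * H \<in> carrier_mat m p" using 1 H by simp
    have 3: "W * X * H * transpose_mat X \<in> carrier_mat m m" using 2 XT by simp
    show ?thesis
      unfolding b_def
      using assoc_mult_mat_vec[OF 3 W y] assoc_mult_mat_vec[OF 2 XT Wy]
        assoc_mult_mat_vec[OF 1 H(1) XWy]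
        assoc_mult_mat_vec[OF W X, of "H *\<^sub>v (transpose_mat X *\<^sub>v (W *\<^sub>v y))"]
        H XWy by simp
  qed
  then have Py: "(W - W * X * H * transpose_mat X * W) *\<^sub>v y = W *\<^sub>v r"
    using W X H XT y Xb unfolding r_def
    by (subst minus_mult_distrib_mat_vec[of _ m m]) (auto simp: mult_minus_distrib_mat_vec[of _ m m])
  have normal: "transpose_mat X *\<^sub>v (W *\<^sub>v r) = 0\<^sub>v p"
  proof -
    have "transpose_mat X *\<^sub>v (W *\<^sub>v (X *\<^sub>v b)) = G *\<^sub>v b"
      using X XT W b Xb unfolding G_def weighted_gram_def W_def[symmetric]
      by (simp add: assoc_mult_mat_vec[of _ p m _ p] assoc_mult_mat_vec[of _ p m _ m])
    also have "\<dots> = transpose_mat X *\<^sub>v (W *\<^sub>v y)"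
      unfolding b_def using assoc_mult_mat_vec[OF G H(1) XWy] H(2) XWy by simp
    finally have "transpose_mat X *\<^sub>v (W *\<^sub>v (X *\<^sub>v b)) = transpose_mat X *\<^sub>v (W *\<^sub>v y)" .
    moreover have "transpose_mat X *\<^sub>v (W *\<^sub>v r)
        = transpose_mat X *\<^sub>v (W *\<^sub>v y) - transpose_mat X *\<^sub>v (W *\<^sub>v (X *\<^sub>v b))"
      unfolding r_def using W XT y Xb Wy
      by (simp add: mult_minus_distrib_mat_vec[of _ m m] mult_minus_distrib_mat_vec[of _ p m])
    ultimately show ?thesis using XWy by simp
  qed
  have "y = r + X *\<^sub>v b"
    using y Xb X by (intro eq_vecI) (auto simp: r_def)
  then have "scalar_prod y (W *\<^sub>v r) = scalar_prod r (W *\<^sub>v r) + scalar_prod (X *\<^sub>v b) (W *\<^sub>v r)"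
    using add_scalar_prod_distrib[OF r Xb Wr] by simp
  also have "scalar_prod (X *\<^sub>v b) (W *\<^sub>v r) = scalar_prod (transpose_mat X *\<^sub>v (W *\<^sub>v r)) b"
    using transpose_vec_mult_scalar[OF X b Wr] comm_scalar_prod[OF Xb Wr] by simp
  also have "\<dots> = 0" using normal b by simp
  also have "scalar_prod r (W *\<^sub>v r) + 0 = (\<Sum>u<m. w u * (r $ u)\<^sup>2)"
    by (simp add: W_def mat_diag_quadratic_form[OF r])
  also have "\<dots> \<ge> 0" using w by (intro sum_nonneg) auto
  finally show ?thesis using Py by (simp add: H_def G_def)
qed

section \<open>Integrability from the tail\<close>

text \<open>
  Continuity on the closed half-line, including 0, bounds the function on every compact initial
  interval, so only the decay at infinity has to be compared with a power.
\<close>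

lemma set_integrable_if_continuous_powr_tail:
  fixes f :: "real \<Rightarrow> real"
  assumes cont: "continuous_on {0..} f" and tail: "f \<in> O(\<lambda>A. A powr e)" and e: "e < -1"
  shows "set_integrable lborel {0<..} f"
proof -
  obtain C where C: "\<forall>\<^sub>F A in at_top. norm (f A) \<le> C * norm (A powr e)"
    using landau_o.bigE[OF tail] by blast
  then obtain N0 where N0: "\<And>A. A \<ge> N0 \<Longrightarrow> \<bar>f A\<bar> \<le> C * A powr e"
    by (auto simp: eventually_at_top_linorder)
  define N where "N = max 1 N0"
  have N: "0 < N" by (simp add: N_def)
  have head: "set_integrable lborel {0..N} f"
    by (intro borel_integrable_atLeastAtMost' continuous_on_subset[OF cont]) auto
  have "set_integrable lebesgue {N..} (\<lambda>A. A powr e)"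
    using has_integral_powr_to_inf[OF e N]
    by (subst absolutely_integrable_on_iff_nonneg) (auto simp: integrable_on_def)
  then have "set_integrable lborel {N..} (\<lambda>A. A powr e)"
    unfolding set_integrable_def by (subst (asm) integrable_completion) auto
  then have dom: "set_integrable lborel {N..} (\<lambda>A. C * A powr e)"
    by simp
  have meas: "set_borel_measurable lborel {N..} f"
    using borel_measurable_continuous_on_indicator[OF _ continuous_on_subset[OF cont], of "{N..}"] N
    by (simp add: set_borel_measurable_def)
  have "set_integrable lborel {N..} f"
  proof (rule set_integrable_bound[OF dom meas])
    show "AE A in lborel. A \<in> {N..} \<longrightarrow> norm (f A) \<le> norm (C * A powr e)"
      using N0 by (intro AE_I2) (force simp: N_def)
  qed
  then have "set_integrable lborel ({0..N} \<union> {N..}) f"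
    using head by (intro set_integrable_Un) auto
  then show ?thesis
    by (rule set_integrable_subset) auto
qed

section \<open>The residual likelihood as a function of the variance component\<close>

lemma design_carrier: "design p x m \<in> carrier_mat m p"
  by (simp add: design_def carrier_matI)

lemma det_Vmat: "det (Vmat D m A) = (\<Prod>u<m. A + D (Suc u))"
  by (simp add: Vmat_def det_mat_diag)

lemma minv_Vmat:
  assumes "\<And>u. u < m \<Longrightarrow> A + D (Suc u) \<noteq> 0"
  shows "minv (Vmat D m A) = mat_diag m (\<lambda>u. 1 / (A + D (Suc u)))"
  using assms by (simp add: Vmat_def minv_mat_diag)

lemma trace_Vinv2_eq:
  assumes "\<And>u. u < m \<Longrightarrow> A + D (Suc u) \<noteq> 0"
  shows "trace_Vinv2 D m A = (\<Sum>u<m. 1 / (A + D (Suc u))\<^sup>2)"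
proof -
  have "trace_Vinv2 D m A
      = sum_list (diag_mat (mat_diag m (\<lambda>u. 1 / (A + D (Suc u)) * (1 / (A + D (Suc u))))))"
    using assms
    by (simp add: trace_Vinv2_def minv_Vmat numeral_2_eq_2 left_mult_one_mat[OF mat_diag_dim]
        carrier_matD(1)[OF mat_diag_dim])
  also have "\<dots> = (\<Sum>u<m. 1 / (A + D (Suc u)) * (1 / (A + D (Suc u))))"
    by (simp add: diag_mat_def mat_diag_def sum_list_distinct_conv_sum_set lessThan_atLeast0
        sum.list_conv_set_nth)
  finally show ?thesis
    by (simp add: power2_eq_square)
qed

lemma XVX_eq_weighted_gram:
  assumes "\<And>u. u < m \<Longrightarrow> A + D (Suc u) \<noteq> 0"
  shows "XVX p x D m A = weighted_gram m (design p x m) (\<lambda>u. 1 / (A + D (Suc u)))"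
  using assms by (simp add: XVX_def weighted_gram_def minv_Vmat)

context
  fixes p m i :: nat and x :: "nat \<Rightarrow> real vec" and D :: "nat \<Rightarrow> real" and y :: "real vec"
  assumes D_pos: "\<And>j. 1 \<le> j \<Longrightarrow> 0 < D j"
    and rank: "vec_space.rank m (design p x m) = p"
    and y: "y \<in> carrier_vec m"
begin

lemma variance_pos: "0 \<le> A \<Longrightarrow> 0 < A + D (Suc u)"
  using D_pos[of "Suc u"] by simp

lemma det_XVX_pos:
  assumes "0 \<le> A"
  shows "0 < det (XVX p x D m A)"
  using variance_pos[OF assms]
  by (simp add: XVX_eq_weighted_gram det_weighted_gram_pos[OF design_carrier rank]
      less_imp_neq[symmetric])

lemma det_Vmat_pos: "0 \<le> A \<Longrightarrow> 0 < det (Vmat D m A)"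
  by (simp add: det_Vmat prod_pos variance_pos)

lemma Pmat_quadratic_form_nonneg:
  assumes A: "0 \<le> A"
  shows "0 \<le> scalar_prod y (Pmat p x D m A *\<^sub>v y)"
proof -
  have nz: "A + D (Suc u) \<noteq> 0" for u using variance_pos[OF A, of u] by simp
  have "det (weighted_gram m (design p x m) (\<lambda>u. 1 / (A + D (Suc u)))) \<noteq> 0"
    using det_XVX_pos[OF A] nz by (simp add: XVX_eq_weighted_gram)
  then show ?thesis
    unfolding Pmat_def XVX_eq_weighted_gram[of m A D p x, OF nz] minv_Vmat[of m A D, OF nz]
    by (intro residual_quadratic_form_nonneg[OF design_carrier] y)
      (simp_all add: variance_pos[OF A] less_imp_le)
qed

lemma L_RE_continuous: "continuous_on {0..} (L_RE p x D m y)"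
  unfolding continuous_on_def
proof
  fix A :: real assume "A \<in> {0..}"
  then have A: "0 \<le> A" by simp
  let ?F = "at A within {0..}"
  have V: "mat_tendsto m m (Vmat D m) (Vmat D m A) ?F"
    unfolding Vmat_def by (intro mat_tendsto_mat_diag tendsto_intros)
  have W: "mat_tendsto m m (\<lambda>A. minv (Vmat D m A)) (minv (Vmat D m A)) ?F"
    using V det_Vmat_pos[OF A] by (intro mat_tendsto_minv) auto
  have X: "mat_tendsto m p (\<lambda>_. design p x m) (design p x m) ?F"
    and XT: "mat_tendsto p m (\<lambda>_. transpose_mat (design p x m)) (transpose_mat (design p x m)) ?F"
    using design_carrier[of p x m] by (auto intro!: mat_tendsto_const)
  have G: "mat_tendsto p p (XVX p x D m) (XVX p x D m A) ?F"
    unfolding XVX_def by (rule mat_tendsto_mult[OF mat_tendsto_mult[OF XT W] X])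
  have H: "mat_tendsto p p (\<lambda>A. minv (XVX p x D m A)) (minv (XVX p x D m A)) ?F"
    using G det_XVX_pos[OF A] by (intro mat_tendsto_minv) auto
  have P: "mat_tendsto m m (Pmat p x D m) (Pmat p x D m A) ?F"
    unfolding Pmat_def
    by (rule mat_tendsto_minus[OF W mat_tendsto_mult[OF mat_tendsto_mult[OF mat_tendsto_mult[OF
              mat_tendsto_mult[OF W X] H] XT] W]])
  show "(L_RE p x D m y \<longlongrightarrow> L_RE p x D m y A) ?F"
    unfolding L_RE_def using det_Vmat_pos[OF A] det_XVX_pos[OF A]
    by (intro tendsto_intros mat_tendsto_det[OF V] mat_tendsto_det[OF G]
        mat_tendsto_quadratic_form[OF P y]) auto
qed

lemma prior_factor_continuous:
  "continuous_on {0..} (\<lambda>A. trace_Vinv2 D m A * (A + D i) * A)"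
proof -
  have "continuous_on {0..} (\<lambda>A. (\<Sum>u<m. 1 / (A + D (Suc u))\<^sup>2) * (A + D i) * A)"
    using variance_pos by (intro continuous_intros) (force dest: less_imp_neq)
  moreover have "(\<Sum>u<m. 1 / (A + D (Suc u))\<^sup>2) = trace_Vinv2 D m A" if "A \<in> {0..}" for A
    using variance_pos[of A] that by (intro trace_Vinv2_eq[symmetric]) (simp add: less_imp_neq[symmetric])
  ultimately show ?thesis
    by (subst continuous_on_cong[OF refl]) auto
qed

text \<open>
  The trace decays like \<open>1 / A\<^sup>2\<close>, which the factors \<open>A + D i\<close> and \<open>A\<close> exactly compensate.
  So at infinity the prior contributes no power of \<open>A\<close>.
\<close>

lemma prior_factor_bigo: "(\<lambda>A. trace_Vinv2 D m A * (A + D i) * A) \<in> O(\<lambda>_. 1)"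
proof -
  have tr: "trace_Vinv2 D m \<in> O(\<lambda>A. 1 / A\<^sup>2)"
  proof (rule bigoI[where c = "real m"])
    show "\<forall>\<^sub>F A in at_top. norm (trace_Vinv2 D m A) \<le> real m * norm (1 / A\<^sup>2)"
      using eventually_gt_at_top[of 0]
    proof eventually_elim
      fix A :: real assume A: "0 < A"
      have nz: "A + D (Suc u) \<noteq> 0" for u using variance_pos[of A u] A by simp
      have "(\<Sum>u<m. 1 / (A + D (Suc u))\<^sup>2) \<le> (\<Sum>u<m. 1 / A\<^sup>2)"
        using A D_pos by (intro sum_mono divide_left_mono power_mono) (auto intro: less_imp_le simp: nz)
      moreover have "0 \<le> (\<Sum>u<m. 1 / (A + D (Suc u))\<^sup>2)"
        by (intro sum_nonneg) simp
      ultimately show "norm (trace_Vinv2 D m A) \<le> real m * norm (1 / A\<^sup>2)"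
        by (simp add: trace_Vinv2_eq[of m A D, OF nz])
    qed
  qed
  have lin: "(\<lambda>A. A + D i) \<in> O(\<lambda>A. A)"
  proof (rule bigoI[where c = "1 + \<bar>D i\<bar>"])
    show "\<forall>\<^sub>F A in at_top. norm (A + D i) \<le> (1 + \<bar>D i\<bar>) * norm A"
      using eventually_ge_at_top[of 1]
    proof eventually_elim
      fix A :: real assume A: "1 \<le> A"
      then have "\<bar>D i\<bar> * 1 \<le> \<bar>D i\<bar> * A" by (intro mult_left_mono) auto
      then show "norm (A + D i) \<le> (1 + \<bar>D i\<bar>) * norm A" using A by (simp add: algebra_simps)
    qed
  qed
  have "(\<lambda>A. trace_Vinv2 D m A * (A + D i) * A) \<in> O(\<lambda>A. 1 / A\<^sup>2 * A * A)"
    by (intro landau_o.big.mult tr lin) simp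
  also have "(\<lambda>A::real. 1 / A\<^sup>2 * A * A) \<in> O(\<lambda>_. 1)"
    by (rule bigoI[where c = 1]) (auto simp: power2_eq_square)
  finally show ?thesis .
qed

lemma det_Vmat_bigo: "(\<lambda>A. det (Vmat D m A) powr (-1/2)) \<in> O(\<lambda>A. A powr (- real m / 2))"
proof (rule bigoI[where c = 1])
  show "\<forall>\<^sub>F A in at_top. norm (det (Vmat D m A) powr (-1/2)) \<le> 1 * norm (A powr (- real m / 2))"
    using eventually_gt_at_top[of 0]
  proof eventually_elim
    fix A :: real assume A: "0 < A"
    have "(\<Prod>u<m. A) \<le> (\<Prod>u<m. A + D (Suc u))"
      using A D_pos by (intro prod_mono) (auto intro: less_imp_le)
    then have "A powr real m \<le> det (Vmat D m A)"
      using A by (simp add: det_Vmat powr_realpow)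
    then have "det (Vmat D m A) powr (-1/2) \<le> (A powr real m) powr (-1/2)"
      using A by (intro powr_mono2') auto
    then show "norm (det (Vmat D m A) powr (-1/2)) \<le> 1 * norm (A powr (- real m / 2))"
      by (simp add: powr_powr)
  qed
qed

text \<open>
  Multiplying \<open>X' V\<^sup>-\<^sup>1 X\<close> by \<open>A\<close> turns its weights into \<open>A / (A + D u)\<close>, which tend to 1.
  A positive limit gives a lower bound on the determinant of order \<open>A\<close> to the power \<open>-p\<close>
  without any expansion of the determinant into minors.
\<close>

lemma scaled_det_XVX_tendsto:
  "((\<lambda>A. A powr real p * det (XVX p x D m A))
    \<longlongrightarrow> det (weighted_gram m (design p x m) (\<lambda>_. 1))) at_top"
proof (rule Lim_transform_eventually)
  let ?X = "design p x m"
  have "((\<lambda>A. A / (A + D (Suc u))) \<longlongrightarrow> 1) at_top" for u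
  proof (rule Lim_transform_eventually)
    have "((\<lambda>A. D (Suc u) / (A + D (Suc u))) \<longlongrightarrow> 0) at_top"
      using D_pos[of "Suc u"]
      by (intro real_tendsto_divide_at_top[OF tendsto_const] filterlim_at_top_mono[OF filterlim_ident])
        simp
    then show "((\<lambda>A. 1 - D (Suc u) / (A + D (Suc u))) \<longlongrightarrow> 1) at_top"
      using tendsto_diff[OF tendsto_const[of "1::real"]] by fastforce
    show "\<forall>\<^sub>F A in at_top. 1 - D (Suc u) / (A + D (Suc u)) = A / (A + D (Suc u))"
      using eventually_gt_at_top[of 0]
      by eventually_elim (use D_pos[of "Suc u"] in \<open>simp add: field_simps\<close>)
  qed
  then show "((\<lambda>A. det (weighted_gram m ?X (\<lambda>u. A / (A + D (Suc u)))))
      \<longlongrightarrow> det (weighted_gram m ?X (\<lambda>_. 1))) at_top"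
    by - (rule mat_tendsto_det, rule mat_tendsto_weighted_gram[OF design_carrier], blast)
  show "\<forall>\<^sub>F A in at_top. det (weighted_gram m ?X (\<lambda>u. A / (A + D (Suc u))))
      = A powr real p * det (XVX p x D m A)"
    using eventually_gt_at_top[of 0]
  proof eventually_elim
    fix A :: real assume A: "0 < A"
    have nz: "A + D (Suc u) \<noteq> 0" for u using variance_pos[of A u] A by simp
    have "weighted_gram m ?X (\<lambda>u. A / (A + D (Suc u)))
        = A \<cdot>\<^sub>m weighted_gram m ?X (\<lambda>u. 1 / (A + D (Suc u)))"
    proof -
      have "mat_diag m (\<lambda>u. A / (A + D (Suc u))) = A \<cdot>\<^sub>m mat_diag m (\<lambda>u. 1 / (A + D (Suc u)))"
        by (intro eq_matI) (auto simp: mat_diag_def)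
      moreover have "transpose_mat ?X \<in> carrier_mat p m"
        using design_carrier by simp
      ultimately show ?thesis
        by (simp add: weighted_gram_def mult_smult_distrib[of _ p m _ m]
            mult_smult_assoc_mat[of _ p m _ p, OF _ design_carrier])
    qed
    then have "det (weighted_gram m ?X (\<lambda>u. A / (A + D (Suc u)))) = A ^ p * det (XVX p x D m A)"
      using carrier_matD(2)[OF weighted_gram_carrier[OF design_carrier[of p x m]]]
      by (simp add: XVX_eq_weighted_gram[of m A D p x, OF nz])
    then show "det (weighted_gram m ?X (\<lambda>u. A / (A + D (Suc u)))) = A powr real p * det (XVX p x D m A)"
      using A by (simp add: powr_realpow)
  qed
qed

lemma det_XVX_bigo: "(\<lambda>A. det (XVX p x D m A) powr (-1/2)) \<in> O(\<lambda>A. A powr (real p / 2))"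
proof -
  let ?K = "det (weighted_gram m (design p x m) (\<lambda>_. 1))"
  have "0 < ?K" by (intro det_weighted_gram_pos[OF design_carrier rank]) simp
  then have "((\<lambda>A. (A powr real p * det (XVX p x D m A)) powr (-1/2)) \<longlongrightarrow> ?K powr (-1/2)) at_top"
    by (intro tendsto_powr scaled_det_XVX_tendsto tendsto_const) simp
  then have "(\<lambda>A. (A powr real p * det (XVX p x D m A)) powr (-1/2)) \<in> O(\<lambda>_. 1)"
    by (intro bigoI_tendsto[where c = "?K powr (-1/2)"]) simp_all
  then have "(\<lambda>A. A powr (real p / 2) * (A powr real p * det (XVX p x D m A)) powr (-1/2))
      \<in> O(\<lambda>A. A powr (real p / 2) * 1)"
    by (intro landau_o.big.mult) auto
  moreover have "\<forall>\<^sub>F A in at_top. A powr (real p / 2) * (A powr real p * det (XVX p x D m A)) powr (-1/2)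
      = det (XVX p x D m A) powr (-1/2)"
    using eventually_gt_at_top[of 0]
  proof eventually_elim
    fix A :: real assume A: "0 < A"
    then show "A powr (real p / 2) * (A powr real p * det (XVX p x D m A)) powr (-1/2)
      = det (XVX p x D m A) powr (-1/2)"
      using det_XVX_pos[of A] by (simp add: powr_mult powr_powr powr_minus)
  qed
  ultimately show ?thesis
    by (simp add: landau_o.big.in_cong)
qed

lemma L_RE_bigo: "L_RE p x D m y \<in> O(\<lambda>A. A powr (- (real m - real p) / 2))"
proof -
  have exp: "(\<lambda>A. exp (- 1 / 2 * scalar_prod y (Pmat p x D m A *\<^sub>v y))) \<in> O(\<lambda>_. 1)"
    by (rule bigoI[where c = 1], rule eventually_mono[OF eventually_ge_at_top[of 0]])
      (simp add: Pmat_quadratic_form_nonneg)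
  have "L_RE p x D m y \<in> O(\<lambda>A. A powr (- real m / 2) * A powr (real p / 2) * 1)"
    unfolding L_RE_def by (intro landau_o.big.mult det_Vmat_bigo det_XVX_bigo exp)
  also have "(\<lambda>A. A powr (- real m / 2) * A powr (real p / 2) * 1)
      = (\<lambda>A. A powr (- (real m - real p) / 2))"
    by (simp add: diff_divide_distrib flip: powr_add)
  finally show ?thesis .
qed

text \<open>
  The exponent \<open>-(m - p) / 2\<close> lies below \<open>-1\<close> precisely when \<open>m > p + 2\<close>, which is where the
  condition on the number of areas enters.
\<close>

lemma posterior_kernel_integrable:
  assumes "p + 2 < m"
  shows "set_integrable lborel {0<..} (\<lambda>A. trace_Vinv2 D m A * (A + D i) * A * L_RE p x D m y A)"
proof (rule set_integrable_if_continuous_powr_tail)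
  show "continuous_on {0..} (\<lambda>A. trace_Vinv2 D m A * (A + D i) * A * L_RE p x D m y A)"
    by (intro continuous_on_mult[OF prior_factor_continuous L_RE_continuous])
  show "(\<lambda>A. trace_Vinv2 D m A * (A + D i) * A * L_RE p x D m y A)
      \<in> O(\<lambda>A. A powr (- (real m - real p) / 2))"
    using landau_o.big.mult[OF prior_factor_bigo L_RE_bigo] by simp
  show "- (real m - real p) / 2 < -1"
  proof -
    have "real (p + 2) < real m" using assms by (simp only: of_nat_less_iff)
    then show ?thesis by simp
  qed
qed

end

theorem theorem3:
  fixes p m i :: nat
    and x :: "nat \<Rightarrow> real vec"
    and D :: "nat \<Rightarrow> real"
    and y :: "real vec"
    and prior posterior :: "real \<Rightarrow> real"
  assumes x_dim: "\<And>j. j \<ge> 1 \<Longrightarrow> x j \<in> carrier_vec p"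
    and D_pos: "\<And>j. j \<ge> 1 \<Longrightarrow> D j > 0"
    and y_dim: "y \<in> carrier_vec m"
    and "p < m"
    and "i \<in> {1..m}"
    and R3: "cond_R3 p x m"
    and R4: "cond_R4 p x"
    and R5: "cond_R5 D"
    and prior: "prior \<propto> (\<lambda>A. trace_Vinv2 D m A * (A + D i) * A)"
    and posterior: "posterior \<propto> (\<lambda>A. prior A * L_RE p x D m y A)"
    and "m > p + 2"
  shows "set_integrable lborel {0<..} posterior"
proof -
  obtain c where c: "\<And>A. 0 < A \<Longrightarrow> prior A = c * (trace_Vinv2 D m A * (A + D i) * A)"
    using prior by (auto simp: prop_to_def)
  obtain c' where c': "\<And>A. 0 < A \<Longrightarrow> posterior A = c' * (prior A * L_RE p x D m y A)"
    using posterior by (auto simp: prop_to_def)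
  have "set_integrable lborel {0<..} (\<lambda>A. trace_Vinv2 D m A * (A + D i) * A * L_RE p x D m y A)"
    using D_pos R3[unfolded cond_R3_def] y_dim \<open>m > p + 2\<close>
    by (rule posterior_kernel_integrable)
  then have "set_integrable lborel {0<..}
      (\<lambda>A. c' * c * (trace_Vinv2 D m A * (A + D i) * A * L_RE p x D m y A))"
    by (rule set_integrable_mult_right)
  also have "?this \<longleftrightarrow> ?thesis"
    by (intro set_integrable_cong) (auto simp: c c')
  finally show ?thesis .
qed

end
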